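(* Let $H$ be a complex Hilbert space, and let $T$ and $U$ be linear operators from subspaces $\mathcal{D}(T),\mathcal{D}(U)\subset H$ into $H$, with adjoints $T^*$ and $U^*$ defined on subspaces $\mathcal{D}(T^* ),\mathcal{D}(U^* )\subset H$. Then $$\big|\langle [T,U]f,f\rangle\big|\le \Delta_f(T^* )\,\Delta_f(U)+\Delta_f(T)\,\Delta_f(U^* )$$ for all $f\in\mathcal{D}(TU)\cap\mathcal{D}(UT)\cap\mathcal{D}(T^* )\cap\mathcal{D}(U^* )$.
   Context: Here "adjoint of $T$, defined on a subspace $\mathcal{D}(T^* )$" means that $T^*:\mathcal{D}(T^* )\to H$ is linear and $\langle Tf,g\rangle=\langle f,T^*g\rangle$ whenever $f\in\mathcal{D}(T)$ and $g\in\mathcal{D}(T^* )$; similarly for $U^*$. The commutator is $[T,U]=TU-UT$, with $\mathcal{D}(TU)=\{f\in\mathcal{D}(U):Uf\in\mathcal{D}(T)\}$ and $\mathcal{D}(UT)=\{f\in\mathcal{D}(T):Tf\in\mathcal{D}(U)\}$. For an operator $S$ and $f\in\mathcal{D}(S)$, $$\Delta_f(S)=\min_{\alpha\in\mathbb{C}}\|Sf-\alpha f\| .$$ (This is the norm of the component of $Sf$ perpendicular to $f$.) *)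

theory Defs
  imports "HOL-Analysis.Analysis"
begin

text \<open>
  The distribution only provides real inner product spaces, so complex Hilbert spaces are set up
  here as type classes on top of the library's real normed spaces.
\<close>

class complex_vector = real_vector +
  fixes scaleC :: "complex \<Rightarrow> 'a \<Rightarrow> 'a"  (infixr \<open>*\<^sub>C\<close> 75)
  assumes scaleC_add_right: "a *\<^sub>C (x + y) = a *\<^sub>C x + a *\<^sub>C y"
    and scaleC_add_left: "(a + b) *\<^sub>C x = a *\<^sub>C x + b *\<^sub>C x"
    and scaleC_scaleC: "a *\<^sub>C b *\<^sub>C x = (a * b) *\<^sub>C x"
    and scaleC_one: "1 *\<^sub>C x = x"
    and scaleR_scaleC: "scaleR r x = complex_of_real r *\<^sub>C x"

global_interpretation complex_vector: vector_space "scaleC :: complex \<Rightarrow> 'a \<Rightarrow> 'a :: complex_vector"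
  defines csubspace = complex_vector.subspace
  by unfold_locales
    (simp_all add: scaleC_add_right scaleC_add_left scaleC_scaleC scaleC_one)

text \<open>
  The inner product is linear in the first argument. The norm axioms inherited from
  \<^class>\<open>real_normed_vector\<close> are redundant given the last axiom (Cauchy--Schwarz); they are
  inherited so that the library's metric notions apply.
\<close>

class complex_inner = complex_vector + real_normed_vector +
  fixes cinner :: "'a \<Rightarrow> 'a \<Rightarrow> complex"
  assumes cinner_commute: "cinner x y = cnj (cinner y x)"
    and cinner_add_left: "cinner (x + y) z = cinner x z + cinner y z"
    and cinner_scaleC_left: "cinner (a *\<^sub>C x) y = a * cinner x y"
    and cinner_ge_zero: "0 \<le> Re (cinner x x)"
    and cinner_eq_zero_iff: "cinner x x = 0 \<longleftrightarrow> x = 0"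
    and norm_eq_sqrt_cinner: "norm x = sqrt (Re (cinner x x))"

class chilbert_space = complex_inner + complete_space

subclass (in chilbert_space) banach ..

instantiation complex :: chilbert_space
begin

definition scaleC_complex :: "complex \<Rightarrow> complex \<Rightarrow> complex"
  where "scaleC_complex a x = a * x"

definition cinner_complex :: "complex \<Rightarrow> complex \<Rightarrow> complex"
  where "cinner_complex x y = x * cnj y"

instance
  by standard
    (auto simp: scaleC_complex_def cinner_complex_def algebra_simps scaleR_conv_of_real
      cmod_def power2_eq_square)

end

text \<open>
  An operator in \<open>H\<close> is given by its domain \<open>D\<close> and a function whose values outside \<open>D\<close> are
  irrelevant. No density of the domain, closedness or boundedness is required.
\<close>

definition linear_operator :: "'a::complex_vector set \<Rightarrow> ('a \<Rightarrow> 'a) \<Rightarrow> bool"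
  where "linear_operator D S \<longleftrightarrow>
    csubspace D \<and>
    (\<forall>x\<in>D. \<forall>y\<in>D. S (x + y) = S x + S y) \<and>
    (\<forall>c. \<forall>x\<in>D. S (c *\<^sub>C x) = c *\<^sub>C S x)"

text \<open>
  \<open>S'\<close>, with domain \<open>D'\<close>, is \<^emph>\<open>an\<close> adjoint of \<open>S\<close>; the domain need not be maximal, and as \<open>D\<close> need
  not be dense, \<open>S'\<close> is not determined by \<open>S\<close> and \<open>D'\<close>.
\<close>

definition is_adjoint ::
    "'a::complex_inner set \<Rightarrow> ('a \<Rightarrow> 'a) \<Rightarrow> 'a set \<Rightarrow> ('a \<Rightarrow> 'a) \<Rightarrow> bool"
  where "is_adjoint D S D' S' \<longleftrightarrow>
    linear_operator D' S' \<and>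
    (\<forall>f\<in>D. \<forall>g\<in>D'. cinner (S f) g = cinner f (S' g))"

text \<open>The domain of the product \<open>TU\<close>, where \<open>T\<close> has domain \<open>DT\<close> and \<open>U\<close> has domain \<open>DU\<close>.\<close>

definition prod_domain :: "'a set \<Rightarrow> 'a set \<Rightarrow> ('a \<Rightarrow> 'a) \<Rightarrow> 'a set"
  where "prod_domain DT DU U = {f \<in> DU. U f \<in> DT}"

text \<open>Meaningful on the intersection of the domains of \<open>TU\<close> and \<open>UT\<close>.\<close>

definition commutator :: "('a \<Rightarrow> 'a) \<Rightarrow> ('a \<Rightarrow> 'a) \<Rightarrow> 'a \<Rightarrow> 'a::minus"
  where "commutator T U f = T (U f) - U (T f)"

text \<open>\<open>LEAST\<close> is the minimum; it is attained by \<open>Delta_attained\<close> below.\<close>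

definition Delta :: "'a::complex_inner \<Rightarrow> ('a \<Rightarrow> 'a) \<Rightarrow> real"
  where "Delta f S = (LEAST m. \<exists>\<alpha>. m = norm (S f - \<alpha> *\<^sub>C f))"

lemma cinner_add_right: "cinner x (y + z) = cinner x y + cinner x z"
  by (metis cinner_commute cinner_add_left complex_cnj_add)

lemma cinner_scaleC_right: "cinner x (a *\<^sub>C y) = cnj a * cinner x y"
  by (metis cinner_commute cinner_scaleC_left complex_cnj_mult)

lemma norm_add_orthogonal:
  fixes x y :: "'a::complex_inner"
  assumes "cinner x y = 0"
  shows "(norm (x + y))\<^sup>2 = (norm x)\<^sup>2 + (norm y)\<^sup>2"
proof -
  have "cinner y x = 0"
    using assms cinner_commute[of y x] by simp
  then show ?thesis
    using assms by (simp add: norm_eq_sqrt_cinner cinner_ge_zero cinner_add_left cinner_add_right)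
qed

lemma Delta_attained:
  fixes f :: "'a::complex_inner"
  obtains \<alpha> where "Delta f S = norm (S f - \<alpha> *\<^sub>C f)"
    and "\<And>\<beta>. norm (S f - \<alpha> *\<^sub>C f) \<le> norm (S f - \<beta> *\<^sub>C f)"
proof -
  define \<alpha> where "\<alpha> = cinner (S f) f / cinner f f"
  define p where "p = S f - \<alpha> *\<^sub>C f"
  have "S f = p + \<alpha> *\<^sub>C f"
    by (simp add: p_def)
  then have "cinner (S f) f = cinner p f + \<alpha> * cinner f f"
    by (simp add: cinner_add_left cinner_scaleC_left)
  moreover have "cinner x 0 = 0" for x :: 'a
    using cinner_add_right[of x 0 0] by simp
  ultimately have orth: "cinner p f = 0"
    by (cases "f = 0") (simp_all add: \<alpha>_def cinner_eq_zero_iff)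
  have min: "norm p \<le> norm (S f - \<beta> *\<^sub>C f)" for \<beta>
  proof -
    have "S f - \<beta> *\<^sub>C f = p + (\<alpha> - \<beta>) *\<^sub>C f"
      by (simp add: p_def complex_vector.scale_left_diff_distrib)
    moreover have "cinner p ((\<alpha> - \<beta>) *\<^sub>C f) = 0"
      by (simp add: cinner_scaleC_right orth)
    ultimately have "(norm p)\<^sup>2 \<le> (norm (S f - \<beta> *\<^sub>C f))\<^sup>2"
      by (simp add: norm_add_orthogonal)
    then show ?thesis
      by (simp add: power2_le_iff_abs_le)
  qed
  have "Delta f S = norm p"
    unfolding Delta_def by (rule Least_equality) (use min p_def in auto)
  with min show thesis
    using that unfolding p_def by blast
qed

end

theory Submission
  imports Defs
begin

text \<open>
  Moving \<open>T\<close> and \<open>U\<close> to the other side of the inner product turns \<open>\<langle>[T,U]f, f\<rangle>\<close> into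
  \<open>\<langle>Uf, T\<^sup>*f\<rangle> - \<langle>Tf, U\<^sup>*f\<rangle>\<close>. Split each of these vectors into a multiple of \<open>f\<close> and a part
  orthogonal to \<open>f\<close> (\<open>cinner_split_perp\<close>). The multiples of \<open>f\<close> contribute
  \<open>\<langle>Uf, f\<rangle>\<langle>f, T\<^sup>*f\<rangle> / \<langle>f, f\<rangle>\<close> to the first term and \<open>\<langle>Tf, f\<rangle>\<langle>f, U\<^sup>*f\<rangle> / \<langle>f, f\<rangle>\<close> to the second;
  by adjointness both are \<open>\<langle>Tf, f\<rangle>\<langle>Uf, f\<rangle> / \<langle>f, f\<rangle>\<close>, so they cancel. What remains involves only
  orthogonal parts, whose norms are bounded by the \<open>\<Delta>\<^sub>f\<close> of the operators
  (\<open>norm_perp_le_Delta\<close>), and the Cauchy--Schwarz inequality concludes.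
\<close>

lemma cinner_diff_left: "cinner (x - y) z = cinner x z - cinner y z"
  using cinner_add_left[of "x - y" y z] by simp

lemma cinner_diff_right: "cinner x (y - z) = cinner x y - cinner x z"
  using cinner_add_right[of x "y - z" z] by simp

lemma cinner_self: "cinner x x = complex_of_real ((norm x)\<^sup>2)"
proof -
  have "Im (cinner x x) = 0"
    using arg_cong[OF cinner_commute[of x x], of Im] by simp
  then show ?thesis
    by (simp add: complex_eq_iff norm_eq_sqrt_cinner cinner_ge_zero)
qed

text \<open>
  For \<open>f = 0\<close> the quotient below is \<open>0\<close>, so \<open>perp 0 x = x\<close> and the results about \<open>perp\<close> hold
  for all \<open>f\<close>.
\<close>

definition perp :: "'a::complex_inner \<Rightarrow> 'a \<Rightarrow> 'a"
  where "perp f x = x - (cinner x f / cinner f f) *\<^sub>C f"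

lemma perp_diff_scaleC: "perp f (x - a *\<^sub>C f) = perp f x"
  by (cases "f = 0")
    (simp_all add: perp_def cinner_diff_left cinner_scaleC_left cinner_eq_zero_iff
      diff_divide_distrib complex_vector.scale_left_diff_distrib)

text \<open>
  In the expansion of \<open>\<langle>perp f x, perp f y\<rangle>\<close>, each of the two mixed terms is minus the contribution
  of the multiples of \<open>f\<close>, and the product of those multiples restores it once.
\<close>

lemma cinner_split_perp:
  "cinner x y = cinner (perp f x) (perp f y) + cinner x f * cinner f y / cinner f f"
proof -
  have "cnj (cinner y f / cinner f f) = cinner f y / cinner f f"
    using cinner_commute[of f y] by (simp add: cinner_self)
  then show ?thesis
    by (cases "cinner f f = 0")
      (simp_all add: perp_def cinner_diff_left cinner_diff_right cinner_scaleC_left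
        cinner_scaleC_right)
qed

lemma norm_split_perp: "(norm x)\<^sup>2 = (norm (perp f x))\<^sup>2 + (cmod (cinner x f))\<^sup>2 / (norm f)\<^sup>2"
proof -
  have "cinner x f * cinner f x = complex_of_real ((cmod (cinner x f))\<^sup>2)"
    using cinner_commute[of f x] complex_norm_square[of "cinner x f"] by simp
  then have "complex_of_real ((norm x)\<^sup>2)
      = complex_of_real ((norm (perp f x))\<^sup>2 + (cmod (cinner x f))\<^sup>2 / (norm f)\<^sup>2)"
    using cinner_split_perp[of x x f] by (simp add: cinner_self)
  then show ?thesis
    by (simp only: of_real_eq_iff)
qed

lemma norm_perp_le: "norm (perp f x) \<le> norm x"
  by (rule power2_le_imp_le) (simp_all add: norm_split_perp[of x f])

lemma cinner_Cauchy_Schwarz: "cmod (cinner x y) \<le> norm x * norm y"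
proof (cases "y = 0")
  case True
  then show ?thesis
    using cinner_diff_right[of x 0 0] by simp
next
  case False
  have "(cmod (cinner x y))\<^sup>2 / (norm y)\<^sup>2 \<le> (norm x)\<^sup>2"
    using norm_split_perp[of x y] by simp
  then have "(cmod (cinner x y))\<^sup>2 \<le> (norm x * norm y)\<^sup>2"
    using False by (simp add: divide_le_eq power_mult_distrib)
  then show ?thesis
    by (rule power2_le_imp_le) simp
qed

text \<open>Subtracting a multiple of \<open>f\<close> from \<open>S f\<close> leaves its orthogonal part unchanged.\<close>

lemma norm_perp_le_Delta: "norm (perp f (S f)) \<le> Delta f S"
proof -
  obtain \<alpha> where "Delta f S = norm (S f - \<alpha> *\<^sub>C f)"
    by (rule Delta_attained)
  then show ?thesis
    using norm_perp_le[of f "S f - \<alpha> *\<^sub>C f"] by (simp add: perp_diff_scaleC)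
qed

lemma cmod_cinner_perp_le_Delta:
  "cmod (cinner (perp f (R f)) (perp f (S f))) \<le> Delta f R * Delta f S"
proof -
  have "norm (perp f (R f)) * norm (perp f (S f)) \<le> Delta f R * Delta f S"
    by (meson mult_mono' norm_ge_zero norm_perp_le_Delta)
  then show ?thesis
    using cinner_Cauchy_Schwarz order_trans by blast
qed

theorem theorem24p4:
  fixes T U Tstar Ustar :: "'h::chilbert_space \<Rightarrow> 'h"
    and DT DU DTstar DUstar :: "'h set"
  assumes "linear_operator DT T"
    and "linear_operator DU U"
    and "is_adjoint DT T DTstar Tstar"
    and "is_adjoint DU U DUstar Ustar"
  shows "\<forall>f \<in> prod_domain DT DU U \<inter> prod_domain DU DT T \<inter> DTstar \<inter> DUstar.
    cmod (cinner (commutator T U f) f)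
      \<le> Delta f Tstar * Delta f U + Delta f T * Delta f Ustar"
proof
  fix f
  assume "f \<in> prod_domain DT DU U \<inter> prod_domain DU DT T \<inter> DTstar \<inter> DUstar"
  then have f: "f \<in> DT" "f \<in> DU" "U f \<in> DT" "T f \<in> DU" "f \<in> DTstar" "f \<in> DUstar"
    by (auto simp: prod_domain_def)
  have adj: "cinner (T (U f)) f = cinner (U f) (Tstar f)"
    "cinner (U (T f)) f = cinner (T f) (Ustar f)"
    "cinner (T f) f = cinner f (Tstar f)"
    "cinner (U f) f = cinner f (Ustar f)"
    using assms f by (auto simp: is_adjoint_def)
  let ?p = "cinner (perp f (U f)) (perp f (Tstar f))"
  let ?q = "cinner (perp f (T f)) (perp f (Ustar f))"
  have "cinner (commutator T U f) f = cinner (U f) (Tstar f) - cinner (T f) (Ustar f)"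
    by (simp add: commutator_def cinner_diff_left adj)
  also have "\<dots> = ?p - ?q"
    using cinner_split_perp[of "U f" "Tstar f" f] cinner_split_perp[of "T f" "Ustar f" f]
    by (simp add: adj)
  finally have "cmod (cinner (commutator T U f) f) \<le> cmod ?p + cmod ?q"
    by (simp add: norm_triangle_ineq4)
  also have "\<dots> \<le> Delta f U * Delta f Tstar + Delta f T * Delta f Ustar"
    by (intro add_mono cmod_cinner_perp_le_Delta)
  finally show "cmod (cinner (commutator T U f) f)
      \<le> Delta f Tstar * Delta f U + Delta f T * Delta f Ustar"
    by (simp add: mult.commute)
qed

end
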